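(* For all $u\in H$ with $\|u\|_0=1$ and $\lambda(u)<\lambda_2$, $$\|u-P_1u\|^2\,\le\,\left(\frac{\lambda_2-\lambda_1}{\lambda_2}\right)^{-1}(\lambda(u)-\lambda_1).$$
   Context: $H$ is a Hilbert space with inner product $a(u,v)$, which induces the energy norm $\|u\|=a(u,u)^{1/2}$ under which $H$ is complete. $H$ carries a further inner product $(u,v)$ inducing the norm $\|u\|_0=(u,u)^{1/2}$. The Rayleigh quotient is $\lambda(u)=a(u,u)/(u,u)$ for $u\ne 0$ in $H$. Its infimum over $H\setminus\{0\}$, denoted $\lambda_1$, is assumed to satisfy $\lambda_1>0$ (so $\lambda_1\|u\|_0^2\le\|u\|^2$ for all $u\in H$) and to be an isolated eigenvalue of finite multiplicity. The eigenspace $E_1=\{u\in H: a(u,\chi)=\lambda_1(u,\chi)\text{ for all }\chi\in H\}$ is thus nonzero and finite dimensional. Let $E_1^\perp=\{u\in H:(u,\chi_1)=0\text{ for all }\chi_1\in E_1\}$, which is assumed to be nonzero, and let $\lambda_2$ be the infimum of $\lambda(u)$ over the nonzero $u\in E_1^\perp$. Since $\lambda_1$ is isolated, $\lambda_2>\lambda_1$. No further assumption on the spectrum is made. $P_1$ is the $a$-orthogonal projection of $H$ onto $E_1$, which is at the same time the orthogonal projection of $H$ onto $E_1$ with respect to $(\cdot,\cdot)$. *)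

theory Defs
  imports "HOL-Analysis.Analysis"
begin

text \<open>
  The Hilbert space \<open>H\<close> is a type of class \<open>{real_inner, complete_space}\<close>: its inner product
  \<open>x \<bullet> y\<close> plays the role of \<open>a(x, y)\<close>, so that \<open>norm\<close> is the energy norm. The further inner
  product is a parameter \<open>b\<close>; \<open>H\<close> need not be complete with respect to the norm it induces.
\<close>

definition inner_product :: "('a::real_vector \<Rightarrow> 'a \<Rightarrow> real) \<Rightarrow> bool" where
  "inner_product b \<longleftrightarrow> bilinear b \<and> (\<forall>u v. b u v = b v u) \<and> (\<forall>u. u \<noteq> 0 \<longrightarrow> b u u > 0)"

definition norm0 :: "('a::real_inner \<Rightarrow> 'a \<Rightarrow> real) \<Rightarrow> 'a \<Rightarrow> real" where
  "norm0 b u = sqrt (b u u)"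

definition rayleigh :: "('a::real_inner \<Rightarrow> 'a \<Rightarrow> real) \<Rightarrow> 'a \<Rightarrow> real" where
  "rayleigh b u = (u \<bullet> u) / b u u"

definition eigenspace :: "('a::real_inner \<Rightarrow> 'a \<Rightarrow> real) \<Rightarrow> real \<Rightarrow> 'a set" where
  "eigenspace b l = {u. \<forall>v. u \<bullet> v = l * b u v}"

text \<open>
  \<open>l\<close> is in the resolvent set iff \<open>a(u, v) - l (u, v) = F(v)\<close> has a unique solution \<open>u \<in> H\<close> for
  every bounded linear functional \<open>F\<close> on \<open>H\<close>. By the Riesz theorem these \<open>F\<close> are the functionals
  \<open>a(f, \<cdot>)\<close>. If \<open>b\<close> is bounded on \<open>H\<close>, as it is when \<open>\<lambda>\<^sub>1 > 0\<close>, then the solution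
  depends continuously on \<open>f\<close> by the bounded inverse theorem.
\<close>

definition spectrum :: "('a::real_inner \<Rightarrow> 'a \<Rightarrow> real) \<Rightarrow> real set" where
  "spectrum b = {l. \<not> (\<forall>f. \<exists>!u. \<forall>v. u \<bullet> v - l * b u v = f \<bullet> v)}"

definition lambda1 :: "('a::real_inner \<Rightarrow> 'a \<Rightarrow> real) \<Rightarrow> real" where
  "lambda1 b = (INF u\<in>- {0}. rayleigh b u)"

definition E1 :: "('a::real_inner \<Rightarrow> 'a \<Rightarrow> real) \<Rightarrow> 'a set" where
  "E1 b = eigenspace b (lambda1 b)"

definition E1_perp :: "('a::real_inner \<Rightarrow> 'a \<Rightarrow> real) \<Rightarrow> 'a set" where
  "E1_perp b = {u. \<forall>v\<in>E1 b. b u v = 0}"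

definition lambda2 :: "('a::real_inner \<Rightarrow> 'a \<Rightarrow> real) \<Rightarrow> real" where
  "lambda2 b = (INF u\<in>E1_perp b - {0}. rayleigh b u)"

text \<open>
  The description is meaningful only if \<open>S\<close> is a subspace that admits an orthogonal projection,
  for example a finite-dimensional one.
\<close>

definition orth_proj :: "'a::real_inner set \<Rightarrow> 'a \<Rightarrow> 'a" where
  "orth_proj S u = (THE v. v \<in> S \<and> (\<forall>w\<in>S. orthogonal (u - v) w))"

definition P1 :: "('a::real_inner \<Rightarrow> 'a \<Rightarrow> real) \<Rightarrow> 'a \<Rightarrow> 'a" where
  "P1 b = orth_proj (E1 b)"

end

theory Submission
  imports Defs
begin

text \<open>
  Put \<open>v = P\<^sub>1 u\<close> and \<open>w = u - v\<close>. As \<open>\<lambda>\<^sub>1 \<noteq> 0\<close>, the element \<open>w\<close> is orthogonal to \<open>E\<^sub>1\<close> in both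
  inner products, so \<open>\<lambda>(u) - \<lambda>\<^sub>1 = a(w, w) - \<lambda>\<^sub>1 (w, w)\<close>. Then use \<open>\<lambda>\<^sub>2 (w, w) \<le> a(w, w)\<close>.
  Both \<open>\<lambda>\<^sub>1 \<le> \<lambda>(u)\<close> and \<open>\<lambda>(u) < \<lambda>\<^sub>2\<close> hold, which gives \<open>\<lambda>\<^sub>1 < \<lambda>\<^sub>2\<close> without spectral theory.
\<close>

text \<open>Gram-Schmidt yields a finite orthogonal set with the same span, and the Fourier sum over
  that set is the projection.\<close>

lemma orthogonal_decomp_span_finite:
  fixes B :: "'a::real_inner set"
  assumes "finite B"
  obtains v where "v \<in> span B" "\<And>w. w \<in> span B \<Longrightarrow> orthogonal (u - v) w"
proof -
  obtain C where C: "finite C" "span C = span B" "pairwise orthogonal C"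
    using basis_orthogonal[OF assms] by blast
  define v where "v = (\<Sum>c\<in>C. ((c \<bullet> u) / (c \<bullet> c)) *\<^sub>R c)"
  have "v \<in> span C"
    unfolding v_def by (intro span_sum span_scale span_base)
  moreover have "orthogonal (u - v) w" if "w \<in> span C" for w
  proof (rule orthogonal_to_span[OF that])
    fix c assume c: "c \<in> C"
    \<comment> \<open>Orthogonality leaves only the summand at \<open>c\<close>. \<open>C\<close>
      may contain 0, so \<open>c = 0\<close>, where \<open>c \<bullet> c\<close> cannot be
      cancelled, is treated apart: both sides are then 0.\<close>
    have "v \<bullet> c = (\<Sum>d\<in>C. if d = c then u \<bullet> c else 0)"
      unfolding v_def inner_sum_left
    proof (rule sum.cong[OF refl])
      fix d assume "d \<in> C"
      then show "(((d \<bullet> u) / (d \<bullet> d)) *\<^sub>R d) \<bullet> c = (if d = c then u \<bullet> c else 0)"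
        using C(3) c by (cases "c = 0") (auto simp: pairwise_def orthogonal_def inner_commute)
    qed
    then show "orthogonal (u - v) c"
      using C(1) c by (simp add: orthogonal_def inner_diff_left)
  qed
  ultimately show thesis
    using that C(2) by auto
qed

text \<open>This justifies the \<open>THE\<close> in \<open>orth_proj\<close>. Two candidates differ
  by an element of the span that is orthogonal to itself, hence zero.\<close>

lemma orth_proj_span_finite:
  fixes B :: "'a::real_inner set"
  assumes "finite B"
  shows "orth_proj (span B) u \<in> span B"
    and "w \<in> span B \<Longrightarrow> orthogonal (u - orth_proj (span B) u) w"
proof -
  let ?P = "\<lambda>v. v \<in> span B \<and> (\<forall>w\<in>span B. orthogonal (u - v) w)"
  have "\<exists>!v. ?P v"
  proof (rule ex_ex1I)
    show "\<exists>v. ?P v"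
      using orthogonal_decomp_span_finite[OF assms, of u] by metis
  next
    fix x y assume xy: "?P x" "?P y"
    then have "x - y \<in> span B"
      by (simp add: span_diff)
    then have "(u - x) \<bullet> (x - y) = 0" "(u - y) \<bullet> (x - y) = 0"
      using xy by (auto simp: orthogonal_def)
    then have "(x - y) \<bullet> (x - y) = 0"
      by (simp add: inner_diff_left)
    then show "x = y"
      by simp
  qed
  from theI'[OF this] show "orth_proj (span B) u \<in> span B"
    and "w \<in> span B \<Longrightarrow> orthogonal (u - orth_proj (span B) u) w"
    unfolding orth_proj_def by auto
qed

text \<open>Quotients are bounded below by 0, so the real infimum is a true lower bound.
  \<open>S = UNIV\<close> serves \<open>lambda1\<close>, \<open>S = E1_perp b\<close> serves
  \<open>lambda2\<close>.\<close>

lemma Inf_rayleigh_le: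
  assumes "inner_product b" and "u \<in> S - {0}"
  shows "(INF v\<in>S - {0}. rayleigh b v) \<le> rayleigh b u"
proof (rule cINF_lower[OF _ assms(2)])
  show "bdd_below (rayleigh b ` (S - {0}))"
    using assms(1) by (intro bdd_belowI2[of _ 0]) (auto simp: rayleigh_def inner_product_def less_imp_le)
qed

theorem theorem3p2:
  fixes b :: "'a::{real_inner, complete_space} \<Rightarrow> 'a \<Rightarrow> real" and u :: 'a
  assumes "inner_product b"
    and "lambda1 b > 0"
    and "lambda1 b isolated_in spectrum b"
    and "E1 b \<noteq> {0}"
    and "\<exists>B. finite B \<and> E1 b = span B"
    and "E1_perp b \<noteq> {0}"
    and "norm0 b u = 1"
    and "rayleigh b u < lambda2 b"
  shows "(norm (u - P1 b u))\<^sup>2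
    \<le> inverse ((lambda2 b - lambda1 b) / lambda2 b) * (rayleigh b u - lambda1 b)"
proof -
  let ?l1 = "lambda1 b" and ?l2 = "lambda2 b"
  define v where "v = P1 b u"
  define w where "w = u - v"
  have bil: "bilinear b" and sym: "b x y = b y x" and pos: "x \<noteq> 0 \<Longrightarrow> b x x > 0" for x y
    using assms(1) by (auto simp: inner_product_def)
  have bu: "b u u = 1"
    using assms(7) by (simp add: norm0_def)
  then have "u \<noteq> 0"
    using bilinear_lzero[OF bil] by auto
  then have "?l1 \<le> rayleigh b u"
    using Inf_rayleigh_le[OF assms(1), of u UNIV] by (simp add: lambda1_def Compl_eq_Diff_UNIV)
  with assms(8) have l12: "?l1 < ?l2"
    by simp
  obtain B where B: "finite B" "E1 b = span B"
    using assms(5) by blast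
  have vE: "v \<in> E1 b" and aw: "x \<in> E1 b \<Longrightarrow> w \<bullet> x = 0" for x
    using orth_proj_span_finite[OF B(1)] by (auto simp: v_def w_def P1_def B(2) orthogonal_def)
  have eig: "x \<bullet> y = ?l1 * b x y" if "x \<in> E1 b" for x y
    using that by (simp add: E1_def eigenspace_def)
  have bw: "b w x = 0" if "x \<in> E1 b" for x
    using eig[OF that, of w] aw[OF that] assms(2) sym[of w x] by (simp add: inner_commute)
  have le: "?l2 * b w w \<le> w \<bullet> w"
  proof (cases "w = 0")
    case True
    then show ?thesis
      using bilinear_lzero[OF bil] by simp
  next
    case False
    moreover have "w \<in> E1_perp b"
      using bw by (simp add: E1_perp_def)
    ultimately have "?l2 \<le> (w \<bullet> w) / b w w"
      using Inf_rayleigh_le[OF assms(1), of w "E1_perp b"] by (simp add: lambda2_def rayleigh_def)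
    then show ?thesis
      using pos[OF False] by (simp add: field_simps)
  qed
  have u: "u = v + w"
    by (simp add: w_def)
  have "b u u = b v v + b w w"
    unfolding u using bw[OF vE] sym[of w v] by (simp add: bilinear_ladd[OF bil] bilinear_radd[OF bil])
  moreover have "u \<bullet> u = ?l1 * b v v + w \<bullet> w"
    unfolding u using aw[OF vE] eig[OF vE, of v] by (simp add: inner_add_left inner_add_right inner_commute)
  \<comment> \<open>By \<open>bu\<close>, \<open>?l1\<close> equals \<open>?l1 * b u u\<close>, so
    the contributions of \<open>v\<close> cancel.\<close>
  ultimately have diff: "rayleigh b u - ?l1 = w \<bullet> w - ?l1 * b w w"
    using bu by (simp add: rayleigh_def algebra_simps flip: distrib_left)
  \<comment> \<open>Subtracting both sides from \<open>?l2 * (w \<bullet> w)\<close> turns this into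
    the next inequality, which is then divided by \<open>?l2 - ?l1 > 0\<close>.\<close>
  have "?l1 * (?l2 * b w w) \<le> ?l1 * (w \<bullet> w)"
    using le assms(2) by simp
  then have "(?l2 - ?l1) * (w \<bullet> w) \<le> ?l2 * (rayleigh b u - ?l1)"
    unfolding diff by (simp add: algebra_simps)
  then show ?thesis
    using l12 by (simp add: power2_norm_eq_inner field_simps flip: v_def w_def)
qed

end
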